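(* Let $L$ be any of the fifteen logics of the modal cube and $\mathcal M_L$ its Nmatrix. For every set of formulas $\Gamma$ and formula $\alpha$, if $\Gamma\models^{\mathcal M_L}\alpha$ then $\Gamma\vdash_L\alpha$.
   Context: Syntax and logics. Formulas: $\alpha ::= p \mid \bot \mid \alpha\to\alpha \mid \Box\alpha$; $\mathrm{For}$ is the set of formulas; $\neg\alpha:=\alpha\to\bot$, $\Diamond\alpha:=\neg\Box\neg\alpha$, $\wedge,\vee$ the usual classical abbreviations. $\mathbf K$: classical propositional axioms, (k) $\Box(\alpha\to\beta)\to(\Box\alpha\to\Box\beta)$, modus ponens, necessitation. Axiom schemes (D) $\Box\alpha\to\Diamond\alpha$, (T) $\Box\alpha\to\alpha$, (B) $\alpha\to\Box\Diamond\alpha$, (4) $\Box\alpha\to\Box\Box\alpha$, (5) $\Diamond\alpha\to\Box\Diamond\alpha$. The modal cube: $\mathbf K,\mathbf{KB},\mathbf{K4},\mathbf{K5},\mathbf{K45},\mathbf{KD},\mathbf{KDB},\mathbf{KD4},\mathbf{KD5},\mathbf{KD45},\mathbf{KT},\mathbf{KTB},\mathbf{S4}=\mathbf{KT4},\mathbf{S5}=\mathbf{KTB45},\mathbf{KB5}=\mathbf{KB45}$. $\Gamma\vdash_L\alpha$ means $\alpha$ or $(\gamma_1\wedge\dots\wedge\gamma_k)\to\alpha$ (some $\gamma_i\in\Gamma$) is a theorem of $L$. Truth values $\mathbf{F},\mathbf{f},\mathbf{f}_2,\mathbf{f}_3,\mathbf{t}_3,\mathbf{t}_2,\mathbf{t},\mathbf{T}$;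 designated set $\mathcal D=\{\mathbf T,\mathbf t,\mathbf t_2,\mathbf t_3\}$. Nmatrix $\mathcal M_L$. Values $V(L)$: all eight values for $\mathbf K,\mathbf{KB},\mathbf{K4},\mathbf{K5},\mathbf{K45}$; $\{\mathbf F,\mathbf f,\mathbf f_2,\mathbf t_2,\mathbf t,\mathbf T\}$ for $\mathbf{KB5}$; $\{\mathbf F,\mathbf f,\mathbf f_3,\mathbf t_3,\mathbf t,\mathbf T\}$ for $\mathbf{KD},\mathbf{KDB},\mathbf{KD4},\mathbf{KD5},\mathbf{KD45}$; $\{\mathbf F,\mathbf f,\mathbf t,\mathbf T\}$ for $\mathbf{KT},\mathbf{KTB},\mathbf{S4},\mathbf{S5}$. Designated values $V(L)\cap\mathcal D$. $\tilde\bot=\{\mathbf F,\mathbf f_2\}$. $\tilde\to(x,y)$, restricted to arguments in $V(L)$, listed for $y=\mathbf F,\mathbf f,\mathbf f_2,\mathbf f_3,\mathbf t_3,\mathbf t_2,\mathbf t,\mathbf T$: $x=\mathbf F$: $\{\mathbf T\}$ for all $y$; $x=\mathbf f$: $\{\mathbf t\},\{\mathbf T,\mathbf t\},\{\mathbf t_2\},\{\mathbf T\},\{\mathbf t\},\{\mathbf T\},\{\mathbf T,\mathbf t\},\{\mathbf T\}$; $x=\mathbf f_2$ and $x=\mathbf f_3$: $\{\mathbf t_3\},\{\mathbf t\},\{\mathbf t_2\},\{\mathbf T\},\{\mathbf t_3\},\{\mathbf t_2\},\{\mathbf t\},\{\mathbf T\}$; $x=\mathbf t_3$: $\{\mathbf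 f_3\}$ for $y\in\{\mathbf F,\mathbf f,\mathbf f_2,\mathbf f_3\}$, $\{\mathbf T\}$ otherwise; $x=\mathbf t_2$: $\{\mathbf F\},\{\mathbf f\},\{\mathbf f_2\},\{\mathbf f_3\},\{\mathbf t_3\},\{\mathbf t_2\},\{\mathbf t_3\},\{\mathbf T\}$; $x=\mathbf t$: $\{\mathbf f\},\{\mathbf f,\mathbf f_3\},\{\mathbf f_3\},\{\mathbf f_3\},\{\mathbf t\},\{\mathbf T\},\{\mathbf T,\mathbf t\},\{\mathbf T\}$; $x=\mathbf T$: $\{\mathbf F\},\{\mathbf f\},\{\mathbf f_2\},\{\mathbf f_3\},\{\mathbf t_3\},\{\mathbf t_2\},\{\mathbf t\},\{\mathbf T\}$. $\tilde\Box$ (argument $\mapsto$ output): $\mathbf K$: $\mathbf F,\mathbf f,\mathbf t_3,\mathbf t\mapsto\{\mathbf F,\mathbf f,\mathbf f_3\}$; $\mathbf f_2,\mathbf t_2\mapsto\{\mathbf t_2\}$; $\mathbf f_3,\mathbf T\mapsto\{\mathbf T,\mathbf t,\mathbf t_3\}$. $\mathbf{KB}$: $\mathbf F,\mathbf f\mapsto\{\mathbf F\}$; $\mathbf f_2,\mathbf t_2\mapsto\{\mathbf t_2\}$; $\mathbf f_3\mapsto\{\mathbf t_3\}$; $\mathbf t_3,\mathbf t\mapsto\{\mathbf F,\mathbf f,\mathbf f_3\}$; $\mathbf T\mapsto\{\mathbf T,\mathbf t,\mathbf t_3\}$. $\mathbf{K4}$: $\mathbf F,\mathbf f,\mathbf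 t_3,\mathbf t\mapsto\{\mathbf F,\mathbf f,\mathbf f_3\}$; $\mathbf f_2,\mathbf t_2\mapsto\{\mathbf t_2\}$; $\mathbf f_3,\mathbf T\mapsto\{\mathbf T\}$. $\mathbf{K5}$: $\mathbf F,\mathbf f,\mathbf t_3,\mathbf t\mapsto\{\mathbf F\}$; $\mathbf f_2,\mathbf t_2\mapsto\{\mathbf t_2\}$; $\mathbf f_3,\mathbf T\mapsto\{\mathbf T,\mathbf t_3\}$. $\mathbf{K45}$: $\mathbf F,\mathbf f,\mathbf t_3,\mathbf t\mapsto\{\mathbf F\}$; $\mathbf f_2,\mathbf t_2\mapsto\{\mathbf t_2\}$; $\mathbf f_3,\mathbf T\mapsto\{\mathbf T\}$. $\mathbf{KB5}$: $\mathbf F,\mathbf f,\mathbf t\mapsto\{\mathbf F\}$; $\mathbf f_2,\mathbf t_2\mapsto\{\mathbf t_2\}$; $\mathbf T\mapsto\{\mathbf T\}$. $\mathbf{KD}$: $\mathbf F,\mathbf f,\mathbf t_3,\mathbf t\mapsto\{\mathbf F,\mathbf f,\mathbf f_3\}$; $\mathbf f_3,\mathbf T\mapsto\{\mathbf T,\mathbf t,\mathbf t_3\}$. $\mathbf{KDB}$: $\mathbf F,\mathbf f\mapsto\{\mathbf F\}$; $\mathbf f_3\mapsto\{\mathbf t_3\}$; $\mathbf t_3,\mathbf t\mapsto\{\mathbf F,\mathbf f,\mathbf f_3\}$; $\mathbf T\mapsto\{\mathbf T,\mathbf t,\mathbf t_3\}$. $\mathbf{KD4}$: $\mathbf F,\mathbf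 t_3\mapsto\{\mathbf F\}$; $\mathbf f,\mathbf t\mapsto\{\mathbf F,\mathbf f,\mathbf f_3\}$; $\mathbf f_3,\mathbf T\mapsto\{\mathbf T\}$. $\mathbf{KD5}$: $\mathbf F,\mathbf f,\mathbf t_3,\mathbf t\mapsto\{\mathbf F\}$; $\mathbf f_3,\mathbf T\mapsto\{\mathbf T,\mathbf t_3\}$. $\mathbf{KD45}$: $\mathbf F,\mathbf f,\mathbf t_3,\mathbf t\mapsto\{\mathbf F\}$; $\mathbf f_3,\mathbf T\mapsto\{\mathbf T\}$. $\mathbf{KT}$: $\mathbf F\mapsto\{\mathbf F\}$; $\mathbf f,\mathbf t\mapsto\{\mathbf F,\mathbf f\}$; $\mathbf T\mapsto\{\mathbf T,\mathbf t\}$. $\mathbf{KTB}$: $\mathbf F,\mathbf f\mapsto\{\mathbf F\}$; $\mathbf t\mapsto\{\mathbf F,\mathbf f\}$; $\mathbf T\mapsto\{\mathbf T,\mathbf t\}$. $\mathbf{S4}$: $\mathbf F\mapsto\{\mathbf F\}$; $\mathbf f,\mathbf t\mapsto\{\mathbf F,\mathbf f\}$; $\mathbf T\mapsto\{\mathbf T\}$. $\mathbf{S5}$: $\mathbf F,\mathbf f,\mathbf t\mapsto\{\mathbf F\}$; $\mathbf T\mapsto\{\mathbf T\}$. A valuation in $\mathcal M_L$ is a map $v:\mathrm{For}\to V(L)$ with $v(\bot)\in\tilde\bot$, $v(\alpha\to\beta)\in\tilde\to(v(\alpha),v(\beta))$, $v(\Box\alpha)\in\tilde\Box(v(\alpha))$;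 $\mathrm{Val}(\mathcal M_L)$ is the set of valuations. Level valuations: $L_0(\mathcal M_L)$ is the set of $v\in\mathrm{Val}(\mathcal M_L)$ such that, if $v(\alpha)\in\{\mathbf f_2,\mathbf t_2\}$ for some $\alpha$, then $v(\beta)\in\{\mathbf f_2,\mathbf t_2\}$ for all $\beta$. $L_{n+1}(\mathcal M_L)=\{v\in L_n(\mathcal M_L)\mid$ for all $\alpha$, if $w(\alpha)\in\mathcal D$ for every $w\in L_n(\mathcal M_L)$, then $v(\alpha)\in\{\mathbf T,\mathbf t_2\}\}$. $L(\mathcal M_L)=\bigcap_{n\ge0}L_n(\mathcal M_L)$. $\Gamma\models^{\mathcal M_L}\alpha$ means: for every $v\in L(\mathcal M_L)$, if $v(\beta)\in\mathcal D$ for all $\beta\in\Gamma$ then $v(\alpha)\in\mathcal D$. *)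

theory Defs
  imports Main
begin

datatype 'p fm = Var 'p | Bot | Imp "'p fm" "'p fm" | Box "'p fm"

definition Neg :: "'p fm \<Rightarrow> 'p fm" where
  "Neg a = Imp a Bot"

definition Dia :: "'p fm \<Rightarrow> 'p fm" where
  "Dia a = Neg (Box (Neg a))"

definition And :: "'p fm \<Rightarrow> 'p fm \<Rightarrow> 'p fm" where
  "And a b = Neg (Imp a (Neg b))"

text \<open>\<open>conj_list a [b, c, \<dots>]\<close> is the conjunction of the nonempty list \<open>a, b, c, \<dots>\<close>.\<close>

primrec conj_list :: "'p fm \<Rightarrow> 'p fm list \<Rightarrow> 'p fm" where
  "conj_list a [] = a"
| "conj_list a (b # bs) = And a (conj_list b bs)"

datatype ax_scheme = AxD | AxT | AxB | Ax4 | Ax5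

primrec ax_instance :: "ax_scheme \<Rightarrow> 'p fm \<Rightarrow> 'p fm" where
  "ax_instance AxD a = Imp (Box a) (Dia a)"
| "ax_instance AxT a = Imp (Box a) a"
| "ax_instance AxB a = Imp a (Box (Dia a))"
| "ax_instance Ax4 a = Imp (Box a) (Box (Box a))"
| "ax_instance Ax5 a = Imp (Dia a) (Box (Dia a))"

datatype modal_logic =
    LK | LKB | LK4 | LK5 | LK45 | LKB5
  | LKD | LKDB | LKD4 | LKD5 | LKD45
  | LKT | LKTB | LS4 | LS5

text \<open>The logics KB5 and S5 are axiomatised as KB45 and KTB45.\<close>

primrec schemes :: "modal_logic \<Rightarrow> ax_scheme set" where
  "schemes LK = {}"
| "schemes LKB = {AxB}"
| "schemes LK4 = {Ax4}"
| "schemes LK5 = {Ax5}"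
| "schemes LK45 = {Ax4, Ax5}"
| "schemes LKB5 = {AxB, Ax4, Ax5}"
| "schemes LKD = {AxD}"
| "schemes LKDB = {AxD, AxB}"
| "schemes LKD4 = {AxD, Ax4}"
| "schemes LKD5 = {AxD, Ax5}"
| "schemes LKD45 = {AxD, Ax4, Ax5}"
| "schemes LKT = {AxT}"
| "schemes LKTB = {AxT, AxB}"
| "schemes LS4 = {AxT, Ax4}"
| "schemes LS5 = {AxT, AxB, Ax4, Ax5}"

text \<open>
  Rules \<open>P1\<close>--\<open>P3\<close> with modus ponens are Church's axiomatisation of classical
  propositional logic in the primitives \<open>Imp\<close> and \<open>Bot\<close>.
\<close>

inductive is_theorem :: "modal_logic \<Rightarrow> 'p fm \<Rightarrow> bool" for L :: modal_logic where
  P1: "is_theorem L (Imp a (Imp b a))"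
| P2: "is_theorem L (Imp (Imp a (Imp b c)) (Imp (Imp a b) (Imp a c)))"
| P3: "is_theorem L (Imp (Neg (Neg a)) a)"
| Kax: "is_theorem L (Imp (Box (Imp a b)) (Imp (Box a) (Box b)))"
| Scheme: "s \<in> schemes L \<Longrightarrow> is_theorem L (ax_instance s a)"
| MP: "is_theorem L (Imp a b) \<Longrightarrow> is_theorem L a \<Longrightarrow> is_theorem L b"
| Nec: "is_theorem L a \<Longrightarrow> is_theorem L (Box a)"

definition derives :: "modal_logic \<Rightarrow> 'p fm set \<Rightarrow> 'p fm \<Rightarrow> bool" where
  "derives L G a \<longleftrightarrow>
     is_theorem L a \<or>
     (\<exists>g gs. set (g # gs) \<subseteq> G \<and> is_theorem L (Imp (conj_list g gs) a))"

text \<open>Upper and lower case distinguish truth values: \<open>VF\<close> and \<open>Vf\<close> differ, as do \<open>VT\<close> and \<open>Vt\<close>.\<close>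

datatype tval = VF | Vf | Vf2 | Vf3 | Vt3 | Vt2 | Vt | VT

definition designated :: "tval set" where
  "designated = {VT, Vt, Vt2, Vt3}"

primrec vals :: "modal_logic \<Rightarrow> tval set" where
  "vals LK = UNIV"
| "vals LKB = UNIV"
| "vals LK4 = UNIV"
| "vals LK5 = UNIV"
| "vals LK45 = UNIV"
| "vals LKB5 = {VF, Vf, Vf2, Vt2, Vt, VT}"
| "vals LKD = {VF, Vf, Vf3, Vt3, Vt, VT}"
| "vals LKDB = {VF, Vf, Vf3, Vt3, Vt, VT}"
| "vals LKD4 = {VF, Vf, Vf3, Vt3, Vt, VT}"
| "vals LKD5 = {VF, Vf, Vf3, Vt3, Vt, VT}"
| "vals LKD45 = {VF, Vf, Vf3, Vt3, Vt, VT}"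
| "vals LKT = {VF, Vf, Vt, VT}"
| "vals LKTB = {VF, Vf, Vt, VT}"
| "vals LS4 = {VF, Vf, Vt, VT}"
| "vals LS5 = {VF, Vf, Vt, VT}"

definition bot_tab :: "tval set" where
  "bot_tab = {VF, Vf2}"

text \<open>
  One table of implication serves all the logics: valuations only take values in \<open>vals L\<close>,
  so both arguments and result are restricted to \<open>vals L\<close>.
\<close>

primrec imp_tab :: "tval \<Rightarrow> tval \<Rightarrow> tval set" where
  "imp_tab VF y = {VT}"
| "imp_tab Vf y = (case y of
     VF \<Rightarrow> {Vt} | Vf \<Rightarrow> {VT, Vt} | Vf2 \<Rightarrow> {Vt2} | Vf3 \<Rightarrow> {VT}
   | Vt3 \<Rightarrow> {Vt} | Vt2 \<Rightarrow> {VT} | Vt \<Rightarrow> {VT, Vt} | VT \<Rightarrow> {VT})"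
| "imp_tab Vf2 y = (case y of
     VF \<Rightarrow> {Vt3} | Vf \<Rightarrow> {Vt} | Vf2 \<Rightarrow> {Vt2} | Vf3 \<Rightarrow> {VT}
   | Vt3 \<Rightarrow> {Vt3} | Vt2 \<Rightarrow> {Vt2} | Vt \<Rightarrow> {Vt} | VT \<Rightarrow> {VT})"
| "imp_tab Vf3 y = (case y of
     VF \<Rightarrow> {Vt3} | Vf \<Rightarrow> {Vt} | Vf2 \<Rightarrow> {Vt2} | Vf3 \<Rightarrow> {VT}
   | Vt3 \<Rightarrow> {Vt3} | Vt2 \<Rightarrow> {Vt2} | Vt \<Rightarrow> {Vt} | VT \<Rightarrow> {VT})"
| "imp_tab Vt3 y = (if y \<in> {VF, Vf, Vf2, Vf3} then {Vf3} else {VT})"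
| "imp_tab Vt2 y = (case y of
     VF \<Rightarrow> {VF} | Vf \<Rightarrow> {Vf} | Vf2 \<Rightarrow> {Vf2} | Vf3 \<Rightarrow> {Vf3}
   | Vt3 \<Rightarrow> {Vt3} | Vt2 \<Rightarrow> {Vt2} | Vt \<Rightarrow> {Vt3} | VT \<Rightarrow> {VT})"
| "imp_tab Vt y = (case y of
     VF \<Rightarrow> {Vf} | Vf \<Rightarrow> {Vf, Vf3} | Vf2 \<Rightarrow> {Vf3} | Vf3 \<Rightarrow> {Vf3}
   | Vt3 \<Rightarrow> {Vt} | Vt2 \<Rightarrow> {VT} | Vt \<Rightarrow> {VT, Vt} | VT \<Rightarrow> {VT})"
| "imp_tab VT y = (case y of
     VF \<Rightarrow> {VF} | Vf \<Rightarrow> {Vf} | Vf2 \<Rightarrow> {Vf2} | Vf3 \<Rightarrow> {Vf3}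
   | Vt3 \<Rightarrow> {Vt3} | Vt2 \<Rightarrow> {Vt2} | Vt \<Rightarrow> {Vt} | VT \<Rightarrow> {VT})"

text \<open>The final branch \<open>{}\<close> of each row below is only reached by arguments outside \<open>vals L\<close>.\<close>

primrec box_tab :: "modal_logic \<Rightarrow> tval \<Rightarrow> tval set" where
  "box_tab LK x =
     (if x \<in> {VF, Vf, Vt3, Vt} then {VF, Vf, Vf3}
      else if x \<in> {Vf2, Vt2} then {Vt2}
      else if x \<in> {Vf3, VT} then {VT, Vt, Vt3} else {})"
| "box_tab LKB x =
     (if x \<in> {VF, Vf} then {VF}
      else if x \<in> {Vf2, Vt2} then {Vt2}
      else if x = Vf3 then {Vt3}
      else if x \<in> {Vt3, Vt} then {VF, Vf, Vf3}
      else if x = VT then {VT, Vt, Vt3} else {})"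
| "box_tab LK4 x =
     (if x \<in> {VF, Vf, Vt3, Vt} then {VF, Vf, Vf3}
      else if x \<in> {Vf2, Vt2} then {Vt2}
      else if x \<in> {Vf3, VT} then {VT} else {})"
| "box_tab LK5 x =
     (if x \<in> {VF, Vf, Vt3, Vt} then {VF}
      else if x \<in> {Vf2, Vt2} then {Vt2}
      else if x \<in> {Vf3, VT} then {VT, Vt3} else {})"
| "box_tab LK45 x =
     (if x \<in> {VF, Vf, Vt3, Vt} then {VF}
      else if x \<in> {Vf2, Vt2} then {Vt2}
      else if x \<in> {Vf3, VT} then {VT} else {})"
| "box_tab LKB5 x =
     (if x \<in> {VF, Vf, Vt} then {VF}
      else if x \<in> {Vf2, Vt2} then {Vt2}
      else if x = VT then {VT} else {})"
| "box_tab LKD x =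
     (if x \<in> {VF, Vf, Vt3, Vt} then {VF, Vf, Vf3}
      else if x \<in> {Vf3, VT} then {VT, Vt, Vt3} else {})"
| "box_tab LKDB x =
     (if x \<in> {VF, Vf} then {VF}
      else if x = Vf3 then {Vt3}
      else if x \<in> {Vt3, Vt} then {VF, Vf, Vf3}
      else if x = VT then {VT, Vt, Vt3} else {})"
| "box_tab LKD4 x =
     (if x \<in> {VF, Vt3} then {VF}
      else if x \<in> {Vf, Vt} then {VF, Vf, Vf3}
      else if x \<in> {Vf3, VT} then {VT} else {})"
| "box_tab LKD5 x =
     (if x \<in> {VF, Vf, Vt3, Vt} then {VF}
      else if x \<in> {Vf3, VT} then {VT, Vt3} else {})"
| "box_tab LKD45 x =
     (if x \<in> {VF, Vf, Vt3, Vt} then {VF}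
      else if x \<in> {Vf3, VT} then {VT} else {})"
| "box_tab LKT x =
     (if x = VF then {VF}
      else if x \<in> {Vf, Vt} then {VF, Vf}
      else if x = VT then {VT, Vt} else {})"
| "box_tab LKTB x =
     (if x \<in> {VF, Vf} then {VF}
      else if x = Vt then {VF, Vf}
      else if x = VT then {VT, Vt} else {})"
| "box_tab LS4 x =
     (if x = VF then {VF}
      else if x \<in> {Vf, Vt} then {VF, Vf}
      else if x = VT then {VT} else {})"
| "box_tab LS5 x =
     (if x \<in> {VF, Vf, Vt} then {VF}
      else if x = VT then {VT} else {})"

definition valuations :: "modal_logic \<Rightarrow> ('p fm \<Rightarrow> tval) set" where
  "valuations L = {v.
     (\<forall>a. v a \<in> vals L) \<and>
     v Bot \<in> bot_tab \<and>
     (\<forall>a b. v (Imp a b) \<in> imp_tab (v a) (v b)) \<and>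
     (\<forall>a. v (Box a) \<in> box_tab L (v a))}"

primrec level :: "modal_logic \<Rightarrow> nat \<Rightarrow> ('p fm \<Rightarrow> tval) set" where
  "level L 0 = {v \<in> valuations L.
     (\<exists>a. v a \<in> {Vf2, Vt2}) \<longrightarrow> (\<forall>b. v b \<in> {Vf2, Vt2})}"
| "level L (Suc n) = {v \<in> level L n.
     \<forall>a. (\<forall>w \<in> level L n. w a \<in> designated) \<longrightarrow> v a \<in> {VT, Vt2}}"

definition level_valuations :: "modal_logic \<Rightarrow> ('p fm \<Rightarrow> tval) set" where
  "level_valuations L = (\<Inter>n. level L n)"

definition entails :: "modal_logic \<Rightarrow> 'p fm set \<Rightarrow> 'p fm \<Rightarrow> bool" where
  "entails L G a \<longleftrightarrow>
     (\<forall>v \<in> level_valuations L. (\<forall>b \<in> G. v b \<in> designated) \<longrightarrow> v a \<in> designated)"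

end

(* A maximal consistent set D assigns to each formula a the truth value that records which of
   a, Box a, Box (Neg a) belong to D; the axioms of L make this a valuation in the Nmatrix of L.
   It belongs to every level: if all valuations of level n designate a, then in particular a lies
   in every maximal consistent set, so a and hence Box a are theorems, and both lie in D. Finally,
   if a is not derivable from G, some maximal consistent set includes G and omits a. *)

theory Submission
  imports Defs
begin

section \<open>Maximal consistent sets\<close>

text \<open>Closure under necessitation is left out on purpose: members may be local assumptions,
  and only theorems may be boxed.\<close>

definition closed_theory :: "modal_logic \<Rightarrow> 'p fm set \<Rightarrow> bool" where
  "closed_theory L T \<longleftrightarrow>
     (\<forall>a. is_theorem L a \<longrightarrow> a \<in> T) \<and> (\<forall>a b. Imp a b \<in> T \<longrightarrow> a \<in> T \<longrightarrow> b \<in> T)"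

text \<open>Maximality is encoded as negation completeness.\<close>

definition mcs :: "modal_logic \<Rightarrow> 'p fm set \<Rightarrow> bool" where
  "mcs L D \<longleftrightarrow> closed_theory L D \<and> Bot \<notin> D \<and> (\<forall>a. a \<in> D \<or> Neg a \<in> D)"

lemma closed_theory_theorem: "closed_theory L T \<Longrightarrow> is_theorem L a \<Longrightarrow> a \<in> T"
  by (simp add: closed_theory_def)

lemma closed_theory_MP: "closed_theory L T \<Longrightarrow> Imp a b \<in> T \<Longrightarrow> a \<in> T \<Longrightarrow> b \<in> T"
  by (auto simp: closed_theory_def)

lemma closed_theory_theorems: "closed_theory L {a. is_theorem L a}"
  by (auto simp: closed_theory_def intro: is_theorem.MP)

text \<open>Deduction theorem in theory form: \<open>{c. Imp b c \<in> T}\<close> is the least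
  closed theory that contains \<open>T\<close> and \<open>b\<close>.\<close>

lemma closed_theory_extend:
  assumes "closed_theory L T"
  shows "closed_theory L {c. Imp b c \<in> T}" "T \<subseteq> {c. Imp b c \<in> T}" "Imp b b \<in> T"
proof -
  show weaken: "T \<subseteq> {c. Imp b c \<in> T}"
    using assms by (auto intro: closed_theory_MP closed_theory_theorem is_theorem.P1)
  have distrib: "Imp b d \<in> T" if "Imp b (Imp c d) \<in> T" "Imp b c \<in> T" for c d
    using that assms by (meson closed_theory_MP closed_theory_theorem is_theorem.P2)
  show "closed_theory L {c. Imp b c \<in> T}"
    unfolding closed_theory_def
    using weaken distrib closed_theory_theorem[OF assms] by blast
  show "Imp b b \<in> T"
    \<comment> \<open>The usual derivation of identity: both premises of \<open>distrib\<close> are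
      instances of \<open>P1\<close>.\<close>
    by (rule distrib[of "Imp b b"]) (use assms in \<open>auto intro: closed_theory_theorem is_theorem.P1\<close>)
qed

lemma closed_theory_ex_falso:
  assumes "closed_theory L T" "Bot \<in> T"
  shows "a \<in> T"
proof -
  have "Neg (Neg a) \<in> T"
    using closed_theory_extend(2)[OF assms(1)] assms(2) unfolding Neg_def[of "Neg a"] by blast
  then show ?thesis
    using assms(1) by (meson closed_theory_MP closed_theory_theorem is_theorem.P3)
qed

text \<open>Assuming \<open>Neg a\<close> (theory \<open>?U\<close>) and then \<open>b\<close>
  (theory \<open>?W\<close>) gives \<open>Bot\<close>. So \<open>?U\<close> contains
  \<open>Neg b\<close>, hence \<open>Bot\<close> again, and double negation elimination
  finishes.\<close>

lemma closed_theory_cases: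
  assumes T: "closed_theory L T" and "Imp b a \<in> T" "Imp (Neg b) a \<in> T"
  shows "a \<in> T"
proof -
  let ?U = "{c. Imp (Neg a) c \<in> T}"
  let ?W = "{c. Imp b c \<in> ?U}"
  have U: "closed_theory L ?U" "T \<subseteq> ?U" "Neg a \<in> ?U"
    using closed_theory_extend[OF T] by blast+
  have W: "closed_theory L ?W" "?U \<subseteq> ?W" "b \<in> ?W"
    using closed_theory_extend[OF U(1)] by blast+
  have "Imp a Bot \<in> ?U"
    using U(3) by (simp only: Neg_def)
  then have "Bot \<in> ?W"
    using closed_theory_MP[OF W(1)] W(2,3) U(2) assms(2) by blast
  then have "Neg b \<in> ?U"
    by (simp add: Neg_def)
  then have "Bot \<in> ?U"
    using closed_theory_MP[OF U(1)] U(2) assms(3) \<open>Imp a Bot \<in> ?U\<close> by blast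
  then have "Neg (Neg a) \<in> T"
    by (simp add: Neg_def)
  then show ?thesis
    using T by (meson closed_theory_MP closed_theory_theorem is_theorem.P3)
qed

text \<open>Zorn's lemma gives a theory maximal among those omitting \<open>a\<close>. This relative
  maximality yields negation completeness: if \<open>b\<close> and \<open>Neg b\<close> were both
  missing, each would imply \<open>a\<close>, which \<open>closed_theory_cases\<close> rules
  out.\<close>

lemma lindenbaum:
  fixes G :: "'p fm set"
  assumes G: "closed_theory L G" and a: "a \<notin> G"
  obtains D where "mcs L D" "G \<subseteq> D" "a \<notin> D"
proof -
  let ?A = "{T. closed_theory L T \<and> G \<subseteq> T \<and> a \<notin> T}"
  have "\<exists>M\<in>?A. \<forall>X\<in>?A. M \<subseteq> X \<longrightarrow> X = M"
  proof (rule subset_Zorn_nonempty)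
    show "?A \<noteq> {}"
      using assms by blast
  next
    fix C assume C: "C \<noteq> {}" "subset.chain ?A C"
    have sub: "C \<subseteq> ?A" and lin: "\<And>X Y. X \<in> C \<Longrightarrow> Y \<in> C \<Longrightarrow> X \<subseteq> Y \<or> Y \<subseteq> X"
      using C(2) by (auto simp: subset_chain_def)
    have "closed_theory L (\<Union>C)"
      unfolding closed_theory_def
    proof (intro conjI allI impI)
      fix b :: "'p fm" assume "is_theorem L b"
      then show "b \<in> \<Union>C"
        using C(1) sub by (blast dest: closed_theory_theorem)
    next
      fix b c assume "Imp b c \<in> \<Union>C" "b \<in> \<Union>C"
      then obtain X where "X \<in> C" "Imp b c \<in> X" "b \<in> X"
        using lin by blast
      then show "c \<in> \<Union>C"
        using sub by (blast dest: closed_theory_MP)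
    qed
    then show "\<Union>C \<in> ?A"
      using C(1) sub by blast
  qed
  then obtain M where "M \<in> ?A" and max: "\<forall>X\<in>?A. M \<subseteq> X \<longrightarrow> X = M"
    by (rule bexE)
  then have M: "closed_theory L M" "G \<subseteq> M" "a \<notin> M"
    by simp_all
  \<comment> \<open>Otherwise the extension of \<open>M\<close> by \<open>b\<close> still omits
    \<open>a\<close>, so it equals \<open>M\<close> by maximality, yet it contains
    \<open>b\<close>.\<close>
  have ext: "Imp b a \<in> M" if "b \<notin> M" for b
  proof (rule ccontr)
    assume "Imp b a \<notin> M"
    moreover have "G \<subseteq> {c. Imp b c \<in> M}"
      using M(2) closed_theory_extend(2)[OF M(1)] by (rule subset_trans)
    ultimately have "{c. Imp b c \<in> M} = M"
      using closed_theory_extend(1,2)[OF M(1)] by (intro max[rule_format]) simp_all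
    then show False
      using closed_theory_extend(3)[OF M(1), of b] that by blast
  qed
  have "b \<in> M \<or> Neg b \<in> M" for b
    using ext[of b] ext[of "Neg b"] closed_theory_cases[OF M(1)] M(3) by metis
  then have "mcs L M"
    using M(1,3) closed_theory_ex_falso[OF M(1)] by (auto simp: mcs_def)
  then show thesis
    using that M by blast
qed

text \<open>Lets Hilbert-style derivations be replaced by membership arguments in arbitrary maximal
  consistent sets.\<close>

lemma is_theorem_iff_mcs: "is_theorem L a \<longleftrightarrow> (\<forall>D. mcs L D \<longrightarrow> a \<in> D)"
proof
  show "is_theorem L a \<Longrightarrow> \<forall>D. mcs L D \<longrightarrow> a \<in> D"
    by (auto simp: mcs_def closed_theory_theorem)
  show "\<forall>D. mcs L D \<longrightarrow> a \<in> D \<Longrightarrow> is_theorem L a"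
    using lindenbaum[OF closed_theory_theorems, of a] by blast
qed

section \<open>Membership in maximal consistent sets, and derivability from premises\<close>

lemma mcs_Bot: "mcs L D \<Longrightarrow> Bot \<notin> D"
  by (simp add: mcs_def)

lemma mcs_Imp:
  assumes "mcs L D"
  shows "Imp a b \<in> D \<longleftrightarrow> (a \<in> D \<longrightarrow> b \<in> D)"
proof
  have D: "closed_theory L D"
    using assms by (simp add: mcs_def)
  show "Imp a b \<in> D \<Longrightarrow> a \<in> D \<longrightarrow> b \<in> D"
    using D closed_theory_MP by blast
  assume "a \<in> D \<longrightarrow> b \<in> D"
  then consider "b \<in> D" | "Imp a Bot \<in> D"
    using assms by (auto simp: mcs_def Neg_def)
  then show "Imp a b \<in> D"
  proof cases
    case 1
    then show ?thesis
      using closed_theory_extend(2)[OF D] by blast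
  next
    case 2
    then show ?thesis
      using closed_theory_ex_falso[OF closed_theory_extend(1)[OF D, of a], of b] by blast
  qed
qed

lemma mcs_Neg: "mcs L D \<Longrightarrow> Neg a \<in> D \<longleftrightarrow> a \<notin> D"
  by (simp add: Neg_def mcs_Imp mcs_Bot)

lemma mcs_And: "mcs L D \<Longrightarrow> And a b \<in> D \<longleftrightarrow> a \<in> D \<and> b \<in> D"
  by (simp add: And_def mcs_Neg mcs_Imp)

lemma mcs_conj_list: "mcs L D \<Longrightarrow> conj_list g gs \<in> D \<longleftrightarrow> set (g # gs) \<subseteq> D"
  by (induction gs arbitrary: g) (auto simp: mcs_And)

text \<open>The empty list covers the first disjunct of \<open>derives\<close>, so that later
  arguments treat both disjuncts alike.\<close>

lemma derives_iff_mcs: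
  "derives L G a \<longleftrightarrow> (\<exists>gs. set gs \<subseteq> G \<and> (\<forall>D. mcs L D \<longrightarrow> set gs \<subseteq> D \<longrightarrow> a \<in> D))"
    (is "_ \<longleftrightarrow> (\<exists>gs. ?P gs)")
proof -
  have ex_list: "(\<exists>xs. Q xs) \<longleftrightarrow> Q [] \<or> (\<exists>x xs. Q (x # xs))" for Q :: "'b list \<Rightarrow> bool"
    by (metis list.exhaust)
  have "derives L G a \<longleftrightarrow> ?P [] \<or> (\<exists>g gs. ?P (g # gs))"
    by (simp add: derives_def is_theorem_iff_mcs mcs_Imp mcs_conj_list del: set_simps) simp
  also have "\<dots> \<longleftrightarrow> (\<exists>gs. ?P gs)"
    by (rule ex_list[symmetric])
  finally show ?thesis .
qed

lemma closed_theory_derives: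
  fixes G :: "'p fm set"
  shows "closed_theory L {a. derives L G a}"
  unfolding closed_theory_def
proof (intro conjI allI impI)
  fix a :: "'p fm" assume "is_theorem L a"
  then show "a \<in> {a. derives L G a}"
    by (simp add: derives_def)
next
  fix a b assume "Imp a b \<in> {a. derives L G a}" "a \<in> {a. derives L G a}"
  then obtain gs hs where
    "set gs \<subseteq> G" "\<And>D. mcs L D \<Longrightarrow> set gs \<subseteq> D \<Longrightarrow> Imp a b \<in> D"
    "set hs \<subseteq> G" "\<And>D. mcs L D \<Longrightarrow> set hs \<subseteq> D \<Longrightarrow> a \<in> D"
    unfolding derives_iff_mcs by blast
  \<comment> \<open>The premises of the two derivations are pooled.\<close>
  then have "set (gs @ hs) \<subseteq> G \<and> (\<forall>D. mcs L D \<longrightarrow> set (gs @ hs) \<subseteq> D \<longrightarrow> b \<in> D)"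
    using mcs_Imp by (metis le_sup_iff set_append)
  then show "b \<in> {a. derives L G a}"
    unfolding derives_iff_mcs by blast
qed

lemma derives_assumption: "a \<in> G \<Longrightarrow> derives L G a"
  unfolding derives_iff_mcs by (rule exI[of _ "[a]"]) simp

section \<open>Boxed formulas in maximal consistent sets\<close>

lemma mcs_Box_theorem: "mcs L D \<Longrightarrow> (\<And>E. mcs L E \<Longrightarrow> a \<in> E) \<Longrightarrow> Box a \<in> D"
  using is_theorem_iff_mcs is_theorem.Nec by blast

lemma mcs_Box_MP:
  assumes "mcs L D" "Box (Imp a b) \<in> D" "Box a \<in> D"
  shows "Box b \<in> D"
  using is_theorem.Kax[of L a b] assms by (simp add: is_theorem_iff_mcs mcs_Imp)

text \<open>\<open>E\<close> ranges over all maximal consistent sets, not over successors of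
  \<open>D\<close>: thus \<open>Imp a b\<close> is a theorem and may be boxed.\<close>

lemma mcs_Box_mono:
  assumes "mcs L D" "Box a \<in> D" "\<And>E. mcs L E \<Longrightarrow> a \<in> E \<Longrightarrow> b \<in> E"
  shows "Box b \<in> D"
proof (rule mcs_Box_MP[OF assms(1) _ assms(2)])
  show "Box (Imp a b) \<in> D"
    using assms(1) by (rule mcs_Box_theorem) (simp add: assms(3) mcs_Imp)
qed

lemma mcs_Box_mono2:
  assumes "mcs L D" "Box a \<in> D" "Box b \<in> D"
    "\<And>E. mcs L E \<Longrightarrow> a \<in> E \<Longrightarrow> b \<in> E \<Longrightarrow> c \<in> E"
  shows "Box c \<in> D"
proof (rule mcs_Box_MP[OF assms(1) _ assms(3)])
  show "Box (Imp b c) \<in> D"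
    using assms(1,2) by (rule mcs_Box_mono) (simp add: assms(4) mcs_Imp)
qed

text \<open>\<open>D\<close> itself stays consistent: it behaves like a world without successors,
  the situation recorded by \<open>Vf2\<close> and \<open>Vt2\<close>.\<close>

lemma mcs_Box_contradiction:
  "mcs L D \<Longrightarrow> Box a \<in> D \<Longrightarrow> Box (Neg a) \<in> D \<Longrightarrow> Box c \<in> D"
  by (erule mcs_Box_mono2[of _ _ a "Neg a"]) (auto simp: mcs_Neg)

lemma mcs_Box_Imp:
  assumes D: "mcs L D"
  shows "Box (Imp a b) \<in> D \<Longrightarrow> Box a \<in> D \<Longrightarrow> Box b \<in> D"
    and "Box (Neg a) \<in> D \<Longrightarrow> Box (Imp a b) \<in> D"
    and "Box b \<in> D \<Longrightarrow> Box (Imp a b) \<in> D"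
    and "Box (Imp a b) \<in> D \<Longrightarrow> Box (Neg b) \<in> D \<Longrightarrow> Box (Neg a) \<in> D"
    and "Box (Neg (Imp a b)) \<in> D \<longleftrightarrow> Box a \<in> D \<and> Box (Neg b) \<in> D"
proof -
  show "Box (Imp a b) \<in> D \<Longrightarrow> Box a \<in> D \<Longrightarrow> Box b \<in> D"
    by (rule mcs_Box_MP[OF D])
  show "Box (Neg a) \<in> D \<Longrightarrow> Box (Imp a b) \<in> D"
    by (erule mcs_Box_mono[OF D]) (simp add: mcs_Neg mcs_Imp)
  show "Box b \<in> D \<Longrightarrow> Box (Imp a b) \<in> D"
    by (erule mcs_Box_mono[OF D]) (simp add: mcs_Imp)
  show "Box (Imp a b) \<in> D \<Longrightarrow> Box (Neg b) \<in> D \<Longrightarrow> Box (Neg a) \<in> D"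
    by (erule (1) mcs_Box_mono2[OF D]) (simp add: mcs_Neg mcs_Imp)
  have "Box a \<in> D" "Box (Neg b) \<in> D" if "Box (Neg (Imp a b)) \<in> D"
    by (rule mcs_Box_mono[OF D that]; simp add: mcs_Neg mcs_Imp)+
  moreover have "Box (Neg (Imp a b)) \<in> D" if "Box a \<in> D" "Box (Neg b) \<in> D"
    by (rule mcs_Box_mono2[OF D that]) (simp add: mcs_Neg mcs_Imp)
  ultimately show "Box (Neg (Imp a b)) \<in> D \<longleftrightarrow> Box a \<in> D \<and> Box (Neg b) \<in> D"
    by blast
qed

lemma mcs_Box_Neg_Neg: "mcs L D \<Longrightarrow> Box (Neg (Neg a)) \<in> D \<longleftrightarrow> Box a \<in> D"
  by (auto elim!: mcs_Box_mono simp: mcs_Neg)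

section \<open>Consequences of the axiom schemes\<close>

lemma mcs_scheme: "mcs L D \<Longrightarrow> s \<in> schemes L \<Longrightarrow> ax_instance s a \<in> D"
  using is_theorem.Scheme is_theorem_iff_mcs by blast

lemma mcs_AxD:
  "mcs L D \<Longrightarrow> AxD \<in> schemes L \<Longrightarrow> Box a \<in> D \<Longrightarrow> Box (Neg a) \<notin> D"
  using mcs_scheme[of L D AxD a] by (simp add: Dia_def mcs_Imp mcs_Neg)

lemma mcs_AxT: "mcs L D \<Longrightarrow> AxT \<in> schemes L \<Longrightarrow> Box a \<in> D \<Longrightarrow> a \<in> D"
  using mcs_scheme[of L D AxT a] by (simp add: mcs_Imp)

text \<open>\<open>Dia (Neg a)\<close> is equivalent to \<open>Neg (Box a)\<close>; this turns the
  instances of (B) and (5) at \<open>Neg a\<close> into statements about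
  \<open>Box a\<close>.\<close>

lemma mcs_Box_Neg_Box_if_Box_Dia:
  assumes "mcs L D" "Box (Dia (Neg a)) \<in> D"
  shows "Box (Neg (Box a)) \<in> D"
  using assms by (rule mcs_Box_mono) (simp add: Dia_def mcs_Neg mcs_Box_Neg_Neg)

lemma mcs_AxB:
  assumes "mcs L D" "AxB \<in> schemes L" "a \<notin> D"
  shows "Box (Neg (Box a)) \<in> D"
  using mcs_scheme[of L D AxB "Neg a"] assms
  by (auto simp: mcs_Imp mcs_Neg intro: mcs_Box_Neg_Box_if_Box_Dia)

lemma mcs_Ax4: "mcs L D \<Longrightarrow> Ax4 \<in> schemes L \<Longrightarrow> Box a \<in> D \<Longrightarrow> Box (Box a) \<in> D"
  using mcs_scheme[of L D Ax4 a] by (simp add: mcs_Imp)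

lemma mcs_Ax5:
  assumes "mcs L D" "Ax5 \<in> schemes L" "Box a \<notin> D"
  shows "Box (Neg (Box a)) \<in> D"
proof -
  have "Dia (Neg a) \<in> D"
    using assms by (simp add: Dia_def mcs_Neg mcs_Box_Neg_Neg)
  then show ?thesis
    using mcs_scheme[of L D Ax5 "Neg a"] assms
    by (auto simp: mcs_Imp intro: mcs_Box_Neg_Box_if_Box_Dia)
qed

text \<open>Two uses of (5): one boxes \<open>Neg (Box (Neg (Box a)))\<close> in \<open>D\<close>,
  the other shows that this formula implies \<open>Box a\<close> in every \<open>E\<close>. This
  excludes \<open>Vt\<close> as a value of \<open>Box a\<close>.\<close>

lemma mcs_Ax5_Box_Box:
  assumes D: "mcs L D" "Ax5 \<in> schemes L" "Box (Neg (Box a)) \<notin> D"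
  shows "Box (Box a) \<in> D"
proof (rule mcs_Box_mono[OF D(1) mcs_Ax5[OF D]])
  fix E assume "mcs L E" "Neg (Box (Neg (Box a))) \<in> E"
  then show "Box a \<in> E"
    using mcs_Ax5[OF _ D(2), of E a] by (auto simp: mcs_Neg)
qed

text \<open>(4) boxes \<open>Box (Neg a)\<close>, which by (D) excludes \<open>Box a\<close>; needed
  for the rows \<open>VF\<close> and \<open>Vt3\<close> of KD4.\<close>

lemma mcs_AxD_Ax4:
  assumes "mcs L D" "AxD \<in> schemes L" "Ax4 \<in> schemes L" "Box (Neg a) \<in> D"
  shows "Box (Neg (Box a)) \<in> D"
  using assms(1) mcs_Ax4[OF assms(1,3,4)]
  by (rule mcs_Box_mono) (use mcs_AxD[OF _ assms(2)] in \<open>auto simp: mcs_Neg\<close>)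

lemma mcs_AxT_Box_Neg_Box:
  assumes "mcs L D" "AxT \<in> schemes L" "Box (Neg a) \<in> D"
  shows "Box (Neg (Box a)) \<in> D"
  using assms(1,3)
  by (rule mcs_Box_mono) (use mcs_AxT[OF _ assms(2)] in \<open>auto simp: mcs_Neg\<close>)

text \<open>(B) gives \<open>Box (Neg (Box a))\<close> and (4) gives \<open>Box (Box a)\<close>, a
  boxed contradiction. This is why KB5 lacks \<open>Vf3\<close> and \<open>Vt3\<close>.\<close>

lemma mcs_AxB_Ax4:
  assumes "mcs L D" "AxB \<in> schemes L" "Ax4 \<in> schemes L" "Box a \<in> D" "a \<notin> D"
  shows "Box c \<in> D"
  using assms by (blast intro: mcs_Box_contradiction mcs_AxB mcs_Ax4)

section \<open>The canonical valuation of a maximal consistent set\<close>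

text \<open>Index 2 marks that both \<open>a\<close> and \<open>Neg a\<close> are boxed, index 3
  that only the one outside \<open>D\<close> is. \<open>VT\<close> and \<open>VF\<close> mean that
  only the one in \<open>D\<close> is boxed, \<open>Vt\<close> and \<open>Vf\<close> that neither
  is.\<close>

definition canonical :: "'p fm set \<Rightarrow> 'p fm \<Rightarrow> tval" where
  "canonical D a =
     (if a \<in> D then
        (if Box a \<in> D then (if Box (Neg a) \<in> D then Vt2 else VT)
         else (if Box (Neg a) \<in> D then Vt3 else Vt))
      else
        (if Box a \<in> D then (if Box (Neg a) \<in> D then Vf2 else Vf3)
         else (if Box (Neg a) \<in> D then VF else Vf)))"

lemma canonical_designated: "canonical D a \<in> designated \<longleftrightarrow> a \<in> D"
  by (simp add: canonical_def designated_def)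

lemma canonical_T_t2: "canonical D a \<in> {VT, Vt2} \<longleftrightarrow> a \<in> D \<and> Box a \<in> D"
  by (simp add: canonical_def)

lemma canonical_f2_t2: "canonical D a \<in> {Vf2, Vt2} \<longleftrightarrow> Box a \<in> D \<and> Box (Neg a) \<in> D"
  by (simp add: canonical_def)

text \<open>(D) excludes the values with index 2; (T) excludes indices 2 and 3, since a boxed
  formula must lie in \<open>D\<close>.\<close>

lemma canonical_vals:
  assumes D: "mcs L D"
  shows "canonical D a \<in> vals L"
proof (cases L)
  case LKB5
  have "Box a \<in> D \<and> Box (Neg a) \<in> D" if "Box a \<in> D" "a \<notin> D"
    using mcs_AxB_Ax4[OF D _ _ that] that LKB5 by simp
  moreover have "Box a \<in> D \<and> Box (Neg a) \<in> D" if "Box (Neg a) \<in> D" "a \<in> D"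
    using mcs_AxB_Ax4[OF D _ _ that(1)] that LKB5 by (simp add: mcs_Neg[OF D])
  ultimately show ?thesis
    using LKB5 by (auto simp: canonical_def)
qed (use mcs_AxD[OF D, of a] mcs_AxT[OF D, of a] mcs_AxT[OF D, of "Neg a"] mcs_Neg[OF D, of a]
      in \<open>auto simp: canonical_def\<close>)

lemma canonical_Imp:
  assumes D: "mcs L D"
  shows "canonical D (Imp a b) \<in> imp_tab (canonical D a) (canonical D b)"
proof -
  \<comment> \<open>The contradiction instances rule out that exactly one of \<open>a\<close> and
    \<open>b\<close> has a value with index 2, so such mixed table entries never arise.\<close>
  note facts = mcs_Box_Imp(1-4)[OF D, where a = a and b = b]
    mcs_Box_contradiction[OF D, of a b] mcs_Box_contradiction[OF D, of a "Neg b"]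
    mcs_Box_contradiction[OF D, of b a] mcs_Box_contradiction[OF D, of b "Neg a"]
  show ?thesis
    by (simp add: canonical_def mcs_Imp[OF D] mcs_Box_Imp(5)[OF D]; use facts in argo)
qed

lemma canonical_Box:
  assumes D: "mcs L D"
  shows "canonical D (Box a) \<in> box_tab L (canonical D a)"
proof -
  \<comment> \<open>Stated as implications from equations for \<open>L\<close>, so that after the
    case split \<open>argo\<close> can treat everything as propositional atoms.\<close>
  have schemes:
    "L = LKB \<or> L = LKB5 \<or> L = LKDB \<or> L = LKTB \<or> L = LS5 \<Longrightarrow> AxB \<in> schemes L"
    "L = LK4 \<or> L = LK45 \<or> L = LKB5 \<or> L = LKD4 \<or> L = LKD45 \<or> L = LS4 \<or> L = LS5
      \<Longrightarrow> Ax4 \<in> schemes L"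
    "L = LK5 \<or> L = LK45 \<or> L = LKB5 \<or> L = LKD5 \<or> L = LKD45 \<or> L = LS5
      \<Longrightarrow> Ax5 \<in> schemes L"
    "L = LKD \<or> L = LKDB \<or> L = LKD4 \<or> L = LKD5 \<or> L = LKD45 \<Longrightarrow> AxD \<in> schemes L"
    "L = LKT \<or> L = LKTB \<or> L = LS4 \<or> L = LS5 \<Longrightarrow> AxT \<in> schemes L"
    by auto
  \<comment> \<open>Taken at \<open>a\<close> this settles the rows \<open>Vf2\<close> and
    \<open>Vt2\<close>; taken at \<open>Box a\<close> it excludes \<open>Vf2\<close> as a value of
    \<open>Box a\<close>.\<close>
  have all_boxed: "Box a \<in> D \<and> Box (Neg a) \<in> D \<and> Box (Box a) \<in> D \<and> Box (Neg (Box a)) \<in> D"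
    if "Box c \<in> D" "Box (Neg c) \<in> D" for c
    using mcs_Box_contradiction[OF D that] by blast
  note facts = schemes all_boxed[of a] all_boxed[of "Box a"]
    mcs_Neg[OF D, of a] mcs_Neg[OF D, of "Box a"]
    mcs_AxB_Ax4[OF D, of a "Neg a"] mcs_AxB_Ax4[OF D, of "Neg a" a]
    mcs_AxD[OF D, of a] mcs_AxD[OF D, of "Box a"]
    mcs_AxT[OF D, of a] mcs_AxT[OF D, of "Box a"] mcs_AxT[OF D, of "Neg a"]
    mcs_AxT[OF D, of "Neg (Box a)"]
    mcs_AxB[OF D, of a] mcs_Ax4[OF D, of a] mcs_Ax5[OF D, of a] mcs_Ax5_Box_Box[OF D, of a]
    mcs_AxD_Ax4[OF D, of a] mcs_AxT_Box_Neg_Box[OF D, of a]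
  show ?thesis
    by (cases L; simp add: canonical_def; use facts in argo)
qed

lemma canonical_valuation:
  assumes "mcs L D"
  shows "canonical D \<in> valuations L"
proof -
  \<comment> \<open>Whether \<open>Box Bot\<close> lies in \<open>D\<close> then decides between
    \<open>VF\<close> and \<open>Vf2\<close>.\<close>
  have "Box (Neg Bot) \<in> D"
    using assms by (rule mcs_Box_theorem) (simp add: mcs_Neg mcs_Bot)
  then have "canonical D Bot \<in> bot_tab"
    using assms by (simp add: canonical_def bot_tab_def mcs_Bot)
  then show ?thesis
    using assms by (simp add: valuations_def canonical_vals canonical_Imp canonical_Box)
qed

lemma canonical_level: "mcs L D \<Longrightarrow> canonical D \<in> level L n"
proof (induction n arbitrary: D)
  case 0
  then show ?case
    using canonical_valuation mcs_Box_contradiction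
    unfolding level.simps mem_Collect_eq canonical_f2_t2 by blast
next
  case (Suc n)
  have "a \<in> D \<and> Box a \<in> D" if "\<forall>w\<in>level L n. w a \<in> designated" for a
  proof -
    \<comment> \<open>The induction hypothesis is needed for every \<open>E\<close>, not only for
      \<open>D\<close>, because boxing \<open>a\<close> requires it to be a theorem.\<close>
    have "a \<in> E" if "mcs L E" for E
      using \<open>\<forall>w\<in>level L n. w a \<in> designated\<close> Suc.IH[OF that] canonical_designated by blast
    then show ?thesis
      using Suc.prems mcs_Box_theorem by blast
  qed
  then show ?case
    unfolding level.simps mem_Collect_eq canonical_T_t2 using Suc by blast
qed

section \<open>Completeness\<close>

theorem theorem2:
  fixes L :: modal_logic and \<Gamma> :: "'p fm set" and \<alpha> :: "'p fm"
  assumes "entails L \<Gamma> \<alpha>"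
  shows "derives L \<Gamma> \<alpha>"
proof (rule ccontr)
  assume "\<not> derives L \<Gamma> \<alpha>"
  then obtain D where D: "mcs L D" "{a. derives L \<Gamma> a} \<subseteq> D" "\<alpha> \<notin> D"
    using lindenbaum[OF closed_theory_derives, of \<alpha> L \<Gamma>] by blast
  have "\<Gamma> \<subseteq> D"
    using D(2) derives_assumption by blast
  moreover have "canonical D \<in> level_valuations L"
    using D(1) canonical_level by (auto simp: level_valuations_def)
  ultimately show False
    using assms D(3) canonical_designated unfolding entails_def by blast
qed

end
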